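(* Let $\sigma > 0$ and let $s$ be the unique maximal real solution of $s''(t) = 2 s(t)^3 - t\, s(t)$ with $s(0) = 0$ and $s'(0) = \sigma$, defined on its maximal open interval of existence $J_s \ni 0$. If $\sigma \geqslant \sqrt{3}/2$, then $s$ experiences blow-up in positive finite time; that is, there is a real number $t^* > 0$ such that $J_s \cap [0,\infty) = [0, t^* )$.
   Context: All functions are real-valued functions of a real variable $t$. The maximal interval $J_s$ is the largest open interval about $0$ on which the solution of the initial value problem exists. Blow-up in positive finite time means that the solution cannot be continued to all of $[0,\infty)$, i.e. $\sup J_s < \infty$. *)

theory Defs
  imports "HOL-Analysis.Analysis"
begin

(* A function on J is encoded as a total function whose values outside J are irrelevant:
   since J is open, the derivatives at points of J depend only on the values on J. *)
definition ivp_solution_on :: "real \<Rightarrow> (real \<Rightarrow> real) \<Rightarrow> real set \<Rightarrow> bool" where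
  "ivp_solution_on \<sigma> s J \<longleftrightarrow>
     open J \<and> is_interval J \<and> 0 \<in> J \<and>
     s 0 = 0 \<and> deriv s 0 = \<sigma> \<and>
     (\<forall>t\<in>J. (s has_real_derivative deriv s t) (at t) \<and>
            (deriv s has_real_derivative (2 * s t ^ 3 - t * s t)) (at t))"

(* J is the largest open interval about 0 carrying a solution. That any two solutions agree on
   the intersection of their intervals is the usual uniqueness theorem (the right-hand side is
   polynomial in t and s), so it is not built into the definition. *)
definition maximal_ivp_solution :: "real \<Rightarrow> (real \<Rightarrow> real) \<Rightarrow> real set \<Rightarrow> bool" where
  "maximal_ivp_solution \<sigma> s J \<longleftrightarrow>
     ivp_solution_on \<sigma> s J \<and> (\<forall>r I. ivp_solution_on \<sigma> r I \<longrightarrow> I \<subseteq> J)"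

end

theory Submission
  imports Defs
begin

text \<open>
  Blow-up is shown by ruling out a solution on all of \<open>[0, \<infinity>)\<close>. Two observations carry the
  argument. The energy \<open>s'\<^sup>2 - s\<^sup>4 + t s\<^sup>2\<close> has derivative \<open>s\<^sup>2 \<ge> 0\<close>, so
  \<open>s'\<^sup>2 \<ge> s\<^sup>4 - t s\<^sup>2 + \<sigma>\<^sup>2\<close> for \<open>t \<ge> 0\<close>. And the force \<open>s (2 s\<^sup>2 - t)\<close> pushes a positive solution upwards
  as soon as it lies above the parabola \<open>2 s\<^sup>2 = t\<close>.

  Completing the square turns the energy bound into
  \<open>s'\<^sup>2 \<ge> (s\<^sup>2 - t/2)\<^sup>2 + \<sigma>\<^sup>2 - t\<^sup>2/4\<close>. For \<open>\<sigma>\<^sup>2 \<ge> 3/4\<close> this keeps the slope above \<open>c = 1/\<surd>2\<close> up to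
  time \<open>1\<close>, which is exactly when the line \<open>c t\<close> meets the parabola \<open>2 s\<^sup>2 = t\<close>; this is where the
  threshold \<open>\<surd>3/2\<close> comes from. So at time \<open>1\<close> the solution is above the parabola with slope larger than
  \<open>c\<close>, and from then on the force is upwards: as long as the slope exceeds \<open>c\<close>, the solution
  stays above the line, hence above the parabola, hence the slope increases
  (\<open>slope_gt\<close>).

  Therefore \<open>s > c t\<close> for all \<open>t > 0\<close>. From \<open>t = 4\<close> on, \<open>t s\<^sup>2\<close> is at most half of \<open>s\<^sup>4\<close>, so
  the energy bound becomes the Riccati inequality \<open>s' \<ge> c s\<^sup>2\<close>, whose positive solutions cannot live
  forever (\<open>no_global_riccati_supersolution\<close>).
\<close>

text \<open>The function \<open>-1/x\<close> would gain at least \<open>c\<close> per unit of time and yet stay negative.\<close>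

lemma no_global_riccati_supersolution:
  fixes x x' :: "real \<Rightarrow> real"
  assumes "c > 0"
    and deriv: "\<And>t. t \<ge> a \<Longrightarrow> (x has_real_derivative x' t) (at t)"
    and pos: "\<And>t. t \<ge> a \<Longrightarrow> x t > 0"
    and growth: "\<And>t. t \<ge> a \<Longrightarrow> x' t \<ge> c * (x t)\<^sup>2"
  shows False
proof -
  define b where "b = a + 1 / (c * x a)"
  have "a \<le> b"
    using \<open>c > 0\<close> pos[of a] by (simp add: b_def)
  have "- (1 / x a) - c * a \<le> - (1 / x b) - c * b"
  proof (rule DERIV_nonneg_imp_nondecreasing[OF \<open>a \<le> b\<close>])
    fix t assume "a \<le> t" "t \<le> b"
    have "((\<lambda>t. - (1 / x t) - c * t) has_real_derivative x' t / (x t)\<^sup>2 - c) (at t)"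
      using pos[OF \<open>a \<le> t\<close>]
      by (auto intro!: derivative_eq_intros deriv[OF \<open>a \<le> t\<close>] simp: power2_eq_square)
    moreover have "x' t / (x t)\<^sup>2 - c \<ge> 0"
      using pos[OF \<open>a \<le> t\<close>] growth[OF \<open>a \<le> t\<close>] by (simp add: pos_le_divide_eq)
    ultimately show "\<exists>y. ((\<lambda>t. - (1 / x t) - c * t) has_real_derivative y) (at t) \<and> 0 \<le> y"
      by blast
  qed
  moreover have "c * b = c * a + 1 / x a"
    using \<open>c > 0\<close> pos[of a] by (simp add: b_def field_simps)
  moreover have "1 / x b > 0"
    using pos[OF \<open>a \<le> b\<close>] by simp
  ultimately show False
    by linarith
qed

text \<open>The situation to be refuted.\<close>

locale forward_global_solution =
  fixes \<sigma> :: real and s v :: "real \<Rightarrow> real"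
  assumes deriv_s: "t \<ge> 0 \<Longrightarrow> (s has_real_derivative v t) (at t)"
    and deriv_v: "t \<ge> 0 \<Longrightarrow> (v has_real_derivative 2 * s t ^ 3 - t * s t) (at t)"
    and s_0: "s 0 = 0"
    and v_0: "v 0 = \<sigma>"
    and \<sigma>_ge: "\<sigma> \<ge> sqrt 3 / 2"
begin

lemma \<sigma>_sq_ge: "\<sigma>\<^sup>2 \<ge> 3 / 4"
  using power_mono[OF \<sigma>_ge, of 2] by (simp add: power_divide)

text \<open>The explicit time dependence of the equation makes the energy grow at the rate \<open>s\<^sup>2\<close>; all other
  terms of its derivative cancel.\<close>

lemma energy_bound:
  assumes "t \<ge> 0"
  shows "(v t)\<^sup>2 \<ge> s t ^ 4 - t * (s t)\<^sup>2 + \<sigma>\<^sup>2"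
proof -
  have "(v 0)\<^sup>2 - s 0 ^ 4 + 0 * (s 0)\<^sup>2 \<le> (v t)\<^sup>2 - s t ^ 4 + t * (s t)\<^sup>2"
  proof (rule DERIV_nonneg_imp_nondecreasing[OF assms])
    fix r :: real assume "0 \<le> r" "r \<le> t"
    have "((\<lambda>t. (v t)\<^sup>2 - s t ^ 4 + t * (s t)\<^sup>2) has_real_derivative (s r)\<^sup>2) (at r)"
      by (auto intro!: derivative_eq_intros deriv_s[OF \<open>0 \<le> r\<close>] deriv_v[OF \<open>0 \<le> r\<close>]
          simp: algebra_simps power2_eq_square power3_eq_cube)
    then show "\<exists>y. ((\<lambda>t. (v t)\<^sup>2 - s t ^ 4 + t * (s t)\<^sup>2) has_real_derivative y) (at r) \<and> 0 \<le> y"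
      by (intro exI[of _ "(s r)\<^sup>2"]) simp
  qed
  then show ?thesis
    by (simp add: s_0 v_0)
qed

lemma energy_bound_square:
  assumes "t \<ge> 0"
  shows "(v t)\<^sup>2 \<ge> ((s t)\<^sup>2 - t / 2)\<^sup>2 + 3 / 4 - t\<^sup>2 / 4"
proof -
  have "((s t)\<^sup>2 - t / 2)\<^sup>2 = s t ^ 4 - t * (s t)\<^sup>2 + t\<^sup>2 / 4"
    by (simp add: power2_diff power_divide flip: power_mult)
  then show ?thesis
    using energy_bound[OF assms] \<sigma>_sq_ge by linarith
qed

lemma continuous_on_v: "continuous_on {0..t} v"
  by (rule DERIV_continuous_on) (auto intro: has_field_derivative_at_within deriv_v)

text \<open>The slope of the line through the origin that crosses the parabola \<open>2 s\<^sup>2 = t\<close> at \<open>t = 1\<close>.\<close>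

definition c :: real where "c = 1 / sqrt 2"

lemma c_pos: "c > 0" and c_sq: "c\<^sup>2 = 1 / 2"
  by (simp_all add: c_def power_divide)

lemma s_gt_line:
  assumes "t > 0" and slope: "\<And>r. 0 < r \<Longrightarrow> r < t \<Longrightarrow> v r > c"
  shows "s t > c * t"
proof -
  obtain r where "0 < r" "r < t" "s t - s 0 = (t - 0) * v r"
    using MVT2[OF \<open>t > 0\<close>, of s v] deriv_s by auto
  then show ?thesis
    using slope[of r] \<open>t > 0\<close> by (simp add: s_0 mult.commute)
qed

lemma s_sq_gt:
  assumes "t > 0" "s t > c * t"
  shows "(s t)\<^sup>2 > t\<^sup>2 / 2"
  using power_strict_mono[OF assms(2), of 2] c_pos assms(1) by (simp add: power_mult_distrib c_sq)

lemma slope_gt_until_1: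
  assumes "0 \<le> t" "t \<le> 1"
  shows "v t > c"
proof -
  \<comment> \<open>The energy controls only \<open>v\<^sup>2\<close>; the sign of \<open>v\<close> is inherited from time \<open>0\<close> by continuity.\<close>
  have sign: "v r > c" if "0 \<le> r" "(v r)\<^sup>2 > c\<^sup>2" and nz: "\<And>q. 0 \<le> q \<Longrightarrow> q \<le> r \<Longrightarrow> v q \<noteq> 0" for r
  proof -
    have "v r > 0"
    proof (rule ccontr)
      assume "\<not> v r > 0"
      moreover have "v 0 \<ge> 0"
        using order_trans[OF _ \<sigma>_ge, of 0] by (simp add: v_0)
      ultimately obtain q where "0 \<le> q" "q \<le> r" "v q = 0"
        using IVT2'[of v r 0 0] continuous_on_v \<open>0 \<le> r\<close> by fastforce
      then show False
        using nz by blast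
    qed
    then show ?thesis
      using power2_less_imp_less[OF that(2)] by simp
  qed
  have nz: "v r \<noteq> 0" if "0 \<le> r" "r \<le> 1" for r
  proof -
    have "r\<^sup>2 \<le> 1"
      using that by (simp add: power_le_one)
    then have "(v r)\<^sup>2 > 0"
      using energy_bound_square[OF that(1)] zero_le_power2[of "(s r)\<^sup>2 - r / 2"] by linarith
    then show ?thesis
      by auto
  qed
  have before_1: "v r > c" if "0 \<le> r" "r < 1" for r
  proof (rule sign)
    have "r\<^sup>2 < 1"
      using that by (simp add: power_less_one_iff)
    then show "(v r)\<^sup>2 > c\<^sup>2"
      using energy_bound_square[OF that(1)] zero_le_power2[of "(s r)\<^sup>2 - r / 2"]
      unfolding c_sq by linarith
  qed (use nz that in auto)
  \<comment> \<open>At time \<open>1\<close> the term \<open>\<sigma>\<^sup>2 - t\<^sup>2/4\<close> only gives \<open>v \<ge> c\<close>; strictness comes from the square,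
    because the solution has already passed the line.\<close>
  have "v 1 > c"
  proof (rule sign)
    have "(s 1)\<^sup>2 > 1 / 2"
      using s_sq_gt[of 1] s_gt_line[of 1] before_1 by simp
    then have "((s 1)\<^sup>2 - 1 / 2)\<^sup>2 > 0"
      by simp
    then show "(v 1)\<^sup>2 > c\<^sup>2"
      using energy_bound_square[of 1] unfolding c_sq power_one by linarith
  qed (use nz in auto)
  then show ?thesis
    using before_1 assms by (cases "t = 1") auto
qed

text \<open>After time \<open>1\<close> the line \<open>c t\<close> runs above the parabola \<open>2 s\<^sup>2 = t\<close>. If the slope ever returned
  to \<open>c\<close>, then up to the first such time the solution would lie above the line, hence be convex from
  time \<open>1\<close> on; but a slope that exceeds \<open>c\<close> at time \<open>1\<close> and does not decrease cannot reach \<open>c\<close>.\<close>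

lemma slope_gt:
  assumes "t \<ge> 0"
  shows "v t > c"
proof (rule ccontr)
  assume "\<not> v t > c"
  define A where "A = {0..t} \<inter> v -` {..c}"
  define r where "r = Inf A"
  have "closed A"
    unfolding A_def by (intro continuous_closed_preimage continuous_on_v) auto
  moreover have "A \<noteq> {}" "bdd_below A"
    using \<open>\<not> v t > c\<close> \<open>t \<ge> 0\<close> by (auto simp: A_def)
  ultimately have "r \<in> A"
    unfolding r_def by (rule closed_contains_Inf[rotated 2])
  then have "0 \<le> r" "r \<le> t" "v r \<le> c"
    by (auto simp: A_def)
  then have "1 < r"
    using slope_gt_until_1[of r] by force
  have before: "v q > c" if "0 \<le> q" "q < r" for q
  proof (rule ccontr)
    assume "\<not> v q > c"
    then have "q \<in> A"
      using that \<open>r \<le> t\<close> by (simp add: A_def)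
    then show False
      using cInf_lower[OF \<open>q \<in> A\<close> \<open>bdd_below A\<close>] that by (simp add: r_def)
  qed
  have "v 1 \<le> v r"
  proof (rule DERIV_nonneg_imp_nondecreasing[where f = v])
    fix q assume q: "1 \<le> q" "q \<le> r"
    then have line: "s q > c * q"
      using s_gt_line[of q] before by simp
    then have "s q > 0"
      using c_pos q mult_nonneg_nonneg[of c q] by linarith
    have "q * 1 \<le> q * q"
      using q by (intro mult_left_mono) auto
    then have "q \<le> q\<^sup>2"
      by (simp add: power2_eq_square)
    then have "2 * (s q)\<^sup>2 - q \<ge> 0"
      using s_sq_gt[OF _ line] q by simp
    then have "s q * (2 * (s q)\<^sup>2 - q) \<ge> 0"
      using \<open>s q > 0\<close> by simp
    then have "2 * s q ^ 3 - q * s q \<ge> 0"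
      by (simp add: algebra_simps power2_eq_square power3_eq_cube)
    then show "\<exists>y. (v has_real_derivative y) (at q) \<and> 0 \<le> y"
      using deriv_v[of q] q by auto
  qed (use \<open>1 < r\<close> in simp)
  then show False
    using slope_gt_until_1[of 1] \<open>v r \<le> c\<close> by simp
qed

lemma contradiction: False
proof (rule no_global_riccati_supersolution)
  fix t :: real assume "4 \<le> t"
  then show "(s has_real_derivative v t) (at t)"
    by (simp add: deriv_s)
  have line: "s t > c * t"
    using \<open>4 \<le> t\<close> by (intro s_gt_line slope_gt) auto
  then show "s t > 0"
    using c_pos \<open>4 \<le> t\<close> mult_nonneg_nonneg[of c t] by linarith
  have "4 * t \<le> t * t"
    using \<open>4 \<le> t\<close> by (intro mult_right_mono) auto
  then have "2 * t \<le> t\<^sup>2 / 2"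
    by (simp add: power2_eq_square)
  also have "\<dots> \<le> (s t)\<^sup>2"
    using s_sq_gt[OF _ line] \<open>4 \<le> t\<close> by simp
  finally have "2 * t \<le> (s t)\<^sup>2" .
  then have "2 * t * (s t)\<^sup>2 \<le> (s t)\<^sup>2 * (s t)\<^sup>2"
    by (intro mult_right_mono) auto
  then have "t * (s t)\<^sup>2 \<le> s t ^ 4 / 2"
    by (simp add: power2_eq_square power4_eq_xxxx)
  then have "(v t)\<^sup>2 \<ge> s t ^ 4 / 2"
    using energy_bound[of t] \<open>4 \<le> t\<close> \<sigma>_sq_ge by linarith
  also have "s t ^ 4 / 2 = (c * (s t)\<^sup>2)\<^sup>2"
    by (simp add: power_mult_distrib c_sq flip: power_mult)
  finally show "c * (s t)\<^sup>2 \<le> v t"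
    by (rule power2_le_imp_le) (use slope_gt[of t] c_pos \<open>4 \<le> t\<close> in simp)
qed (rule c_pos)

end

lemma open_interval_bounded_above_Int_atLeast:
  fixes J :: "real set"
  assumes "open J" "is_interval J" "a \<in> J" "bdd_above J"
  shows "\<exists>b>a. J \<inter> {a..} = {a..<b}"
proof (intro exI conjI)
  have lt_Sup: "x < Sup J" if x: "x \<in> J" for x
  proof -
    obtain e where "e > 0" "ball x e \<subseteq> J"
      using \<open>open J\<close> x openE by blast
    then have "x + e / 2 \<in> J"
      by (auto simp: dist_real_def)
    then have "x + e / 2 \<le> Sup J"
      using \<open>bdd_above J\<close> by (rule cSup_upper)
    then show ?thesis
      using \<open>e > 0\<close> by simp
  qed
  then show "a < Sup J"
    using \<open>a \<in> J\<close> .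
  show "J \<inter> {a..} = {a..<Sup J}"
  proof
    show "{a..<Sup J} \<subseteq> J \<inter> {a..}"
    proof
      fix x assume x: "x \<in> {a..<Sup J}"
      then obtain y where "y \<in> J" "x < y"
        using less_cSup_iff[of J x] \<open>a \<in> J\<close> \<open>bdd_above J\<close> by auto
      then show "x \<in> J \<inter> {a..}"
        using x mem_is_interval_1_I[OF \<open>is_interval J\<close> \<open>a \<in> J\<close> \<open>y \<in> J\<close>] by simp
    qed
  qed (use lt_Sup in auto)
qed

theorem theorem5:
  fixes \<sigma> :: real and s :: "real \<Rightarrow> real" and J :: "real set"
  assumes "\<sigma> > 0"
    and "maximal_ivp_solution \<sigma> s J"
    and "\<sigma> \<ge> sqrt 3 / 2"
  shows "\<exists>tstar>0. J \<inter> {0..} = {0..<tstar}"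
proof (rule open_interval_bounded_above_Int_atLeast)
  have sol: "ivp_solution_on \<sigma> s J"
    using assms(2) by (simp add: maximal_ivp_solution_def)
  then show "open J" and J: "is_interval J" "0 \<in> J"
    by (auto simp: ivp_solution_on_def)
  show "bdd_above J"
  proof (rule ccontr)
    assume "\<not> bdd_above J"
    have "t \<in> J" if "t \<ge> 0" for t
    proof -
      obtain y where "y \<in> J" "t \<le> y"
        using \<open>\<not> bdd_above J\<close> by (meson bdd_above.I linear)
      then show ?thesis
        using mem_is_interval_1_I[OF J \<open>y \<in> J\<close>] that by blast
    qed
    then have "forward_global_solution \<sigma> s (deriv s)"
      using sol assms(3) by (unfold_locales) (auto simp: ivp_solution_on_def)
    then show False
      by (rule forward_global_solution.contradiction)
  qed
qed

end
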